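(* Let $S_{\boldsymbol\lambda}\in\boldsymbol B(\ell^2(V))$ be a weighted shift on a directed tree $\mathcal T=(V,E)$ with weights $\boldsymbol\lambda=\{\lambda_v\}_{v\in V^\circ}$, and let $u\in V$ with $\operatorname{Chi}(u)\neq\varnothing$ be such that $\{\|S_{\boldsymbol\lambda}^ne_v\|^2\}_{n=0}^\infty$ is a Stieltjes moment sequence for every $v\in\operatorname{Chi}(u)$; denote by $\mu_v$ its representing measure. Then the following conditions are equivalent: (i) $\{\|S_{\boldsymbol\lambda}^ne_u\|^2\}_{n=0}^\infty$ is a Stieltjes moment sequence; (ii) $S_{\boldsymbol\lambda}$ satisfies the consistency condition at $u$, i.e. $$\sum_{v\in\operatorname{Chi}(u)}|\lambda_v|^2\int_0^\infty\frac1s\,d\mu_v(s)\le1.$$ If (i) holds, then $\mu_v(\{0\})=0$ for every $v\in\operatorname{Chi}(u)$ such that $\lambda_v\ne0$, and the representing measure $\mu_u$ of $\{\|S_{\boldsymbol\lambda}^ne_u\|^2\}_{n=0}^\infty$ is given by $$\mu_u(\sigma)=\sum_{v\in\operatorname{Chi}(u)}|\lambda_v|^2\int_\sigma\frac1s\,d\mu_v(s)+\Big(1-\sum_{v\in\operatorname{Chi}(u)}|\lambda_v|^2\int_0^\infty\frac1s\,d\mu_v(s)\Big)\delta_0(\sigma)$$ for every Borel set $\sigma\subseteq\mathbb R$; moreover, $\mu_u(\{0\})=0$ if and only if $S_{\boldsymbol\lambda}$ satisfies the strong consistency condition at $u$, i.e. $$\sum_{v\in\operatorname{Chi}(u)}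|\lambda_v|^2\int_0^\infty\frac1s\,d\mu_v(s)=1.$$
   Context: A directed tree $\mathcal T=(V,E)$ consists of a nonempty set $V$ (of arbitrary cardinality) of vertices and a set $E\subseteq V\times V\setminus\{(v,v):v\in V\}$ of edges such that: (1) any two distinct vertices $u,v$ are joined by an undirected path, i.e. there are $v_1=u,\dots,v_n=v$ in $V$ ($n\ge 2$) with $(v_j,v_{j+1})\in E$ or $(v_{j+1},v_j)\in E$ for each $j<n$; (2) there is no circuit, i.e. no finite sequence of distinct vertices $u_1,\dots,u_n$ ($n\ge2$) with $(u_j,u_{j+1})\in E$ for $j<n$ and $(u_n,u_1)\in E$; (3) every vertex $v$ that is not a root has a unique vertex $\operatorname{par}(v)$ (its parent) with $(\operatorname{par}(v),v)\in E$; a root is a vertex $v$ for which there is no $u$ with $(u,v)\in E$. A directed tree has at most one root, denoted $\mathrm{root}$ when it exists. $V^\circ$ is $V$ with the root removed (and $V^\circ=V$ if $\mathcal T$ has no root). $\operatorname{Chi}(u)=\{v\in V:(u,v)\in E\}$. $\ell^2(V)$ is the Hilbert space of square summable complex functions on $V$, with orthonormal basis $\{e_u\}_{u\in V}$, $e_u$ being the indicator function of $\{u\}$. For $\boldsymbol\lambda=\{\lambda_v\}_{v\in V^\circ}\subseteq\mathbb C$ and $f\colon V\to\mathbb C$ put $(\Lambda f)(v)=\lambda_v f(\operatorname{par}(v))$ for $v\in V^\circ$ and $(\Lambda f)(\mathrm{root})=0$. The weighted shift $S_{\boldsymbol\lambda}$ is the operator in $\ell^2(V)$ with domain $\{f\in\ell^2(V):\Lambda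 f\in\ell^2(V)\}$ and $S_{\boldsymbol\lambda}f=\Lambda f$. $\boldsymbol B(\mathcal H)$ denotes the bounded operators on $\mathcal H$ with domain $\mathcal H$. A real sequence $\{t_n\}_{n=0}^\infty$ is a Stieltjes moment sequence if there is a positive Borel measure $\mu$ on $\mathbb R$ concentrated on $[0,\infty)$ (a representing measure) with $t_n=\int s^n\,d\mu(s)$ for all $n\ge0$. If $S_{\boldsymbol\lambda}$ is bounded and $\{\|S_{\boldsymbol\lambda}^ne_w\|^2\}_{n=0}^\infty$ is a Stieltjes moment sequence, its representing measure is unique and concentrated on $[0,\|S_{\boldsymbol\lambda}\|^2]$; it is denoted $\mu_w$. Conventions: $\int_0^\infty$ means $\int_{[0,\infty)}$, $\frac10=\infty$ (so $\int_0^\infty\frac1s\,d\mu(s)<\infty$ forces $\mu(\{0\})=0$), and $0\cdot\infty=0$. $\delta_0$ is the Dirac measure at $0$. *)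

theory Defs
  imports "HOL-Probability.Probability"
begin

section \<open>Directed trees\<close>

definition is_root :: "'a set \<Rightarrow> ('a \<times> 'a) set \<Rightarrow> 'a \<Rightarrow> bool" where
  "is_root V E v \<longleftrightarrow> v \<in> V \<and> (\<nexists>u. (u, v) \<in> E)"

definition directed_tree :: "'a set \<Rightarrow> ('a \<times> 'a) set \<Rightarrow> bool" where
  "directed_tree V E \<longleftrightarrow>
     V \<noteq> {} \<and>
     E \<subseteq> V \<times> V - {(v, v) | v. v \<in> V} \<and>
     (\<forall>u\<in>V. \<forall>v\<in>V. u \<noteq> v \<longrightarrow>
        (\<exists>p. length p \<ge> 2 \<and> set p \<subseteq> V \<and> hd p = u \<and> last p = v \<and>
             successively (\<lambda>x y. (x, y) \<in> E \<or> (y, x) \<in> E) p)) \<and>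
     (\<nexists>c. length c \<ge> 2 \<and> distinct c \<and>
          successively (\<lambda>x y. (x, y) \<in> E) c \<and> (last c, hd c) \<in> E) \<and>
     (\<forall>v\<in>V. \<not> is_root V E v \<longrightarrow> (\<exists>!p. (p, v) \<in> E))"

definition nonroots :: "'a set \<Rightarrow> ('a \<times> 'a) set \<Rightarrow> 'a set" where
  "nonroots V E = {v \<in> V. \<not> is_root V E v}"

definition par :: "('a \<times> 'a) set \<Rightarrow> 'a \<Rightarrow> 'a" where
  "par E v = (THE p. (p, v) \<in> E)"

definition Chi :: "'a set \<Rightarrow> ('a \<times> 'a) set \<Rightarrow> 'a \<Rightarrow> 'a set" where
  "Chi V E u = {v \<in> V. (u, v) \<in> E}"

section \<open>The Hilbert space of square summable functions and weighted shifts\<close>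

text \<open>Functions on \<open>V\<close> are represented by functions on the whole type that vanish off \<open>V\<close>.
  The indicator of \<open>{u}\<close> is then the basis vector attached to \<open>u \<in> V\<close>.\<close>

definition l2 :: "'a set \<Rightarrow> ('a \<Rightarrow> complex) set" where
  "l2 V = {f. (\<forall>x. x \<notin> V \<longrightarrow> f x = 0) \<and> (\<lambda>x. (cmod (f x))\<^sup>2) summable_on V}"

definition l2_norm :: "'a set \<Rightarrow> ('a \<Rightarrow> complex) \<Rightarrow> real" where
  "l2_norm V f = sqrt (\<Sum>\<^sub>\<infinity>x\<in>V. (cmod (f x))\<^sup>2)"

text \<open>An operator in \<open>l2 V\<close> is given by its domain \<open>D\<close> and its action \<open>T\<close>, whose values
  off \<open>D\<close> are irrelevant.\<close>

definition l2_bounded_operator ::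
    "'a set \<Rightarrow> ('a \<Rightarrow> complex) set \<Rightarrow> (('a \<Rightarrow> complex) \<Rightarrow> ('a \<Rightarrow> complex)) \<Rightarrow> bool" where
  "l2_bounded_operator V D T \<longleftrightarrow>
     D = l2 V \<and> T ` D \<subseteq> l2 V \<and>
     (\<forall>f\<in>D. \<forall>g\<in>D. T (\<lambda>x. f x + g x) = (\<lambda>x. T f x + T g x)) \<and>
     (\<forall>c. \<forall>f\<in>D. T (\<lambda>x. c * f x) = (\<lambda>x. c * T f x)) \<and>
     (\<exists>C. \<forall>f\<in>D. l2_norm V (T f) \<le> C * l2_norm V f)"

definition wshift ::
    "'a set \<Rightarrow> ('a \<times> 'a) set \<Rightarrow> ('a \<Rightarrow> complex) \<Rightarrow> ('a \<Rightarrow> complex) \<Rightarrow> ('a \<Rightarrow> complex)" where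
  "wshift V E lam f = (\<lambda>v. if v \<in> nonroots V E then lam v * f (par E v) else 0)"

definition wshift_domain ::
    "'a set \<Rightarrow> ('a \<times> 'a) set \<Rightarrow> ('a \<Rightarrow> complex) \<Rightarrow> ('a \<Rightarrow> complex) set" where
  "wshift_domain V E lam = {f \<in> l2 V. wshift V E lam f \<in> l2 V}"

definition wshift_moments ::
    "'a set \<Rightarrow> ('a \<times> 'a) set \<Rightarrow> ('a \<Rightarrow> complex) \<Rightarrow> 'a \<Rightarrow> nat \<Rightarrow> real" where
  "wshift_moments V E lam w n = (l2_norm V ((wshift V E lam ^^ n) (indicator {w})))\<^sup>2"

section \<open>Stieltjes moment sequences\<close>

definition stieltjes_represents :: "real measure \<Rightarrow> (nat \<Rightarrow> real) \<Rightarrow> bool" where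
  "stieltjes_represents M t \<longleftrightarrow>
     sets M = sets borel \<and> emeasure M (- {0..}) = 0 \<and>
     (\<forall>n. integrable M (\<lambda>s. s ^ n) \<and> t n = (\<integral>s. s ^ n \<partial>M))"

definition stieltjes_moment_sequence :: "(nat \<Rightarrow> real) \<Rightarrow> bool" where
  "stieltjes_moment_sequence t \<longleftrightarrow> (\<exists>M. stieltjes_represents M t)"

section \<open>The consistency conditions\<close>

text \<open>In \<^typ>\<open>ennreal\<close> the conventions \<open>1 / 0 = \<infinity>\<close> and \<open>0 * \<infinity> = 0\<close> hold. Since
  \<open>ennreal s = 0\<close> for \<open>s < 0\<close>, the integral of \<open>1 / s\<close> is restricted to the half-line, on
  which the measures in question are concentrated.\<close>

definition recip_integral :: "real measure \<Rightarrow> real set \<Rightarrow> ennreal" where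
  "recip_integral M A = (\<integral>\<^sup>+s\<in>A \<inter> {0..}. 1 / ennreal s \<partial>M)"

definition consistency_sum ::
    "'a set \<Rightarrow> ('a \<times> 'a) set \<Rightarrow> ('a \<Rightarrow> complex) \<Rightarrow> ('a \<Rightarrow> real measure) \<Rightarrow> 'a \<Rightarrow> real set \<Rightarrow> ennreal" where
  "consistency_sum V E lam \<mu> u A =
     (\<Sum>\<^sub>\<infinity>v\<in>Chi V E u. ennreal ((cmod (lam v))\<^sup>2) * recip_integral (\<mu> v) A)"

definition consistent_at ::
    "'a set \<Rightarrow> ('a \<times> 'a) set \<Rightarrow> ('a \<Rightarrow> complex) \<Rightarrow> ('a \<Rightarrow> real measure) \<Rightarrow> 'a \<Rightarrow> bool" where
  "consistent_at V E lam \<mu> u \<longleftrightarrow> consistency_sum V E lam \<mu> u {0..} \<le> 1"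

definition strongly_consistent_at ::
    "'a set \<Rightarrow> ('a \<times> 'a) set \<Rightarrow> ('a \<Rightarrow> complex) \<Rightarrow> ('a \<Rightarrow> real measure) \<Rightarrow> 'a \<Rightarrow> bool" where
  "strongly_consistent_at V E lam \<mu> u \<longleftrightarrow> consistency_sum V E lam \<mu> u {0..} = 1"

end

theory Submission
  imports Defs
begin

text \<open>Put \<open>P = \<Sum>\<^sub>v |\<lambda>\<^sub>v|\<^sup>2 \<mu>\<^sub>v\<close>, the sum being over the children of \<open>u\<close>. The moments of \<open>P\<close> are those of
  \<open>u\<close> shifted by one. They grow at most geometrically, so a representing measure is determined
  by them (Weierstrass approximation on a bounded interval). If \<open>N\<close> represents the moments of \<open>u\<close>,
  then \<open>s dN(s)\<close> has the moments of \<open>P\<close>, hence is \<open>P\<close>, so that \<open>P\<close> has no atom at \<open>0\<close> and \<open>N\<close> is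
  \<open>dP(s) / s\<close> on \<open>(0, \<infinity>)\<close>; the atom of \<open>N\<close> at \<open>0\<close> is the remaining mass. Conversely, if
  \<open>\<integral> 1/s dP(s) \<le> 1\<close>, then \<open>dP(s) / s\<close> together with the missing mass at \<open>0\<close> represents the moments of \<open>u\<close>.\<close>

section \<open>Sums of measures over arbitrary index sets\<close>

text \<open>Finite partial sums are integrals over finite subsets, which gives one inequality. The
  other follows by exhausting the support of \<open>f\<close> with its level sets. Sums over
  children can then be treated by integration theory.\<close>

lemma infsum_eq_nn_integral_count_space:
  fixes f :: "'b \<Rightarrow> ennreal"
  shows "infsum f A = (\<integral>\<^sup>+a. f a \<partial>count_space A)"
proof (rule antisym)
  have "sum f F \<le> (\<integral>\<^sup>+a. f a \<partial>count_space A)" if "finite F" "F \<subseteq> A" for F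
  proof -
    have "sum f F = (\<integral>\<^sup>+a. f a \<partial>count_space F)"
      using that by (simp add: nn_integral_count_space_finite)
    also have "\<dots> = (\<integral>\<^sup>+a. f a * indicator F a \<partial>count_space A)"
      using that by (auto simp: nn_integral_count_space_indicator intro!: nn_integral_cong split: split_indicator)
    also have "\<dots> \<le> (\<integral>\<^sup>+a. f a \<partial>count_space A)"
      by (intro nn_integral_mono) (auto split: split_indicator)
    finally show ?thesis .
  qed
  then show "infsum f A \<le> (\<integral>\<^sup>+a. f a \<partial>count_space A)"
    by (auto simp: nonneg_infsum_complete intro!: SUP_least)
next
  \<comment> \<open>If some level set is infinite, \<open>infsum f A\<close> is already infinite.
    Otherwise the \<open>S n\<close> are finite and increase to the support of \<open>f\<close>, so
    monotone convergence applies.\<close>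
  define S where "S n = {a \<in> A. f a \<ge> ennreal (1 / real (Suc n))}" for n
  show "(\<integral>\<^sup>+a. f a \<partial>count_space A) \<le> infsum f A"
  proof (cases "\<exists>n. infinite (S n)")
    case True
    then obtain n where n: "infinite (S n)" by blast
    have "infsum f (S n) = \<infinity>"
      by (rule infsum_superconst_infinite_ennreal[OF _ _ n, of "ennreal (1 / real (Suc n))"])
        (auto simp: S_def)
    moreover have "infsum f (S n) \<le> infsum f A"
      by (rule infsum_mono_neutral) (auto simp: S_def nonneg_summable_on_complete)
    ultimately show ?thesis by (simp add: top_unique)
  next
    case False
    then have fin: "finite (S n)" for n by blast
    have lim: "f a = (SUP n. f a * indicator (S n) a)" if a: "a \<in> A" for a
    proof (cases "f a = 0")
      case False
      obtain n where n: "ennreal (1 / real (Suc n)) \<le> f a"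
      proof (cases "f a")
        case (real r)
        then have "r > 0" using False by (auto simp: less_le)
        then obtain n where "1 / real (Suc n) < r"
          using reals_Archimedean[of r] by (auto simp: inverse_eq_divide)
        then show ?thesis using real by (intro that[of n]) (simp add: ennreal_leI)
      next
        case top
        then show ?thesis by (intro that[of 0]) auto
      qed
      have "f a * indicator (S n) a = f a" using n a by (simp add: S_def)
      then have "f a \<le> (SUP n. f a * indicator (S n) a)"
        by (metis SUP_upper UNIV_I)
      moreover have "(SUP n. f a * indicator (S n) a) \<le> f a"
        by (auto intro!: SUP_least split: split_indicator)
      ultimately show ?thesis by (rule antisym)
    qed simp
    have Smono: "S n \<subseteq> S (Suc n)" for n
    proof
      fix x assume "x \<in> S n"
      moreover have "ennreal (1 / real (Suc (Suc n))) \<le> ennreal (1 / real (Suc n))"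
        by (intro ennreal_leI) (simp add: field_simps)
      ultimately show "x \<in> S (Suc n)" unfolding S_def by (blast intro: order_trans)
    qed
    have "(\<integral>\<^sup>+a. f a \<partial>count_space A) = (\<integral>\<^sup>+a. (SUP n. f a * indicator (S n) a) \<partial>count_space A)"
      using lim by (intro nn_integral_cong) auto
    also have "\<dots> = (SUP n. \<integral>\<^sup>+a. f a * indicator (S n) a \<partial>count_space A)"
      using Smono by (intro nn_integral_monotone_convergence_SUP incseq_SucI le_funI mult_left_mono)
        (auto split: split_indicator)
    also have "\<dots> \<le> infsum f A"
    proof (rule SUP_least)
      fix n
      have "(\<integral>\<^sup>+a. f a * indicator (S n) a \<partial>count_space A) = (\<Sum>a\<in>S n. f a * indicator (S n) a)"
        by (rule nn_integral_count_space') (use fin in \<open>auto simp: S_def\<close>)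
      also have "\<dots> = infsum f (S n)" using fin by simp
      also have "\<dots> \<le> infsum f A"
        by (rule infsum_mono_neutral) (auto simp: S_def nonneg_summable_on_complete)
      finally show "(\<integral>\<^sup>+a. f a * indicator (S n) a \<partial>count_space A) \<le> infsum f A" .
    qed
    finally show ?thesis .
  qed
qed

text \<open>A vertex may have uncountably many children. Integrating against the counting measure keeps
  monotone convergence in the index available without any countability assumption.\<close>

definition weighted_sum_measure :: "'b set \<Rightarrow> ('b \<Rightarrow> ennreal) \<Rightarrow> ('b \<Rightarrow> real measure) \<Rightarrow> real measure"
  where "weighted_sum_measure I c \<mu> =
    measure_of UNIV (sets borel) (\<lambda>A. \<integral>\<^sup>+v. c v * emeasure (\<mu> v) A \<partial>count_space I)"

lemma sets_weighted_sum_measure [simp, measurable_cong]: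
  "sets (weighted_sum_measure I c \<mu>) = sets borel"
  unfolding weighted_sum_measure_def by (metis sets.sigma_sets_eq sets_measure_of space_borel subset_UNIV Pow_UNIV)

lemma space_weighted_sum_measure [simp]: "space (weighted_sum_measure I c \<mu>) = UNIV"
  using sets_eq_imp_space_eq[OF sets_weighted_sum_measure] by simp

text \<open>Countable additivity is the exchange of a series with the integral over the
  index.\<close>

lemma emeasure_weighted_sum_measure:
  assumes sets: "\<And>v. v \<in> I \<Longrightarrow> sets (\<mu> v) = sets borel" and A: "A \<in> sets borel"
  shows "emeasure (weighted_sum_measure I c \<mu>) A = (\<integral>\<^sup>+v. c v * emeasure (\<mu> v) A \<partial>count_space I)"
  unfolding weighted_sum_measure_def
proof (rule emeasure_measure_of_sigma)
  show "sigma_algebra UNIV (sets (borel :: real measure))"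
    using sets.sigma_algebra_axioms[of borel] by simp
  show "countably_additive (sets borel) (\<lambda>A. \<integral>\<^sup>+v. c v * emeasure (\<mu> v) A \<partial>count_space I)"
  proof (rule countably_additiveI)
    fix B :: "nat \<Rightarrow> real set"
    assume B: "range B \<subseteq> sets borel" "disjoint_family B"
    have "(\<Sum>i. \<integral>\<^sup>+v. c v * emeasure (\<mu> v) (B i) \<partial>count_space I) =
        (\<integral>\<^sup>+v. (\<Sum>i. c v * emeasure (\<mu> v) (B i)) \<partial>count_space I)"
      by (rule nn_integral_suminf[symmetric]) simp
    also have "\<dots> = (\<integral>\<^sup>+v. c v * emeasure (\<mu> v) (\<Union>i. B i) \<partial>count_space I)"
      using B sets by (intro nn_integral_cong) (simp add: suminf_emeasure)
    finally show "(\<Sum>i. \<integral>\<^sup>+v. c v * emeasure (\<mu> v) (B i) \<partial>count_space I) =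
        (\<integral>\<^sup>+v. c v * emeasure (\<mu> v) (\<Union>i. B i) \<partial>count_space I)" .
  qed
qed (use A in \<open>auto simp: positive_def\<close>)

text \<open>Induction from indicators to Borel functions. The limit step uses monotone convergence
  twice, in the variable \<open>s\<close> and in the index \<open>v\<close>.\<close>

lemma nn_integral_weighted_sum_measure:
  assumes sets: "\<And>v. v \<in> I \<Longrightarrow> sets (\<mu> v) = sets borel"
    and f: "f \<in> borel_measurable borel"
  shows "(\<integral>\<^sup>+s. f s \<partial>weighted_sum_measure I c \<mu>) =
    (\<integral>\<^sup>+v. c v * (\<integral>\<^sup>+s. f s \<partial>\<mu> v) \<partial>count_space I)"
  using f
proof (induction rule: borel_measurable_induct)
  case (cong f g)
  then have "f = g" by auto
  with cong show ?case by simp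
next
  case (set A)
  then have "(\<integral>\<^sup>+v. c v * emeasure (\<mu> v) A \<partial>count_space I) =
      (\<integral>\<^sup>+v. c v * (\<integral>\<^sup>+s. indicator A s \<partial>\<mu> v) \<partial>count_space I)"
    using sets by (intro nn_integral_cong) simp
  with set show ?case
    using sets by (simp add: emeasure_weighted_sum_measure)
next
  case (mult f a)
  note [measurable_cong] = sets
  have "(\<integral>\<^sup>+s. a * f s \<partial>weighted_sum_measure I c \<mu>) = a * (\<integral>\<^sup>+v. c v * (\<integral>\<^sup>+s. f s \<partial>\<mu> v) \<partial>count_space I)"
    using mult by (simp add: nn_integral_cmult)
  also have "\<dots> = (\<integral>\<^sup>+v. a * (c v * (\<integral>\<^sup>+s. f s \<partial>\<mu> v)) \<partial>count_space I)"
    by (simp add: nn_integral_cmult)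
  also have "\<dots> = (\<integral>\<^sup>+v. c v * (\<integral>\<^sup>+s. a * f s \<partial>\<mu> v) \<partial>count_space I)"
    using mult sets by (intro nn_integral_cong) (simp add: nn_integral_cmult mult_ac measurable_cong_sets[OF sets refl])
  finally show ?case .
next
  case (add f g)
  have "(\<integral>\<^sup>+s. g s + f s \<partial>weighted_sum_measure I c \<mu>) =
      (\<integral>\<^sup>+v. c v * (\<integral>\<^sup>+s. g s \<partial>\<mu> v) + c v * (\<integral>\<^sup>+s. f s \<partial>\<mu> v) \<partial>count_space I)"
    using add by (simp add: nn_integral_add)
  also have "\<dots> = (\<integral>\<^sup>+v. c v * (\<integral>\<^sup>+s. g s + f s \<partial>\<mu> v) \<partial>count_space I)"
    using add sets by (intro nn_integral_cong) (simp add: nn_integral_add distrib_left measurable_cong_sets[OF sets refl])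
  finally show ?case .
next
  case (seq U)
  have inc: "incseq (\<lambda>i. \<integral>\<^sup>+s. U i s \<partial>\<mu> v)" for v
    using seq by (auto simp: incseq_def le_fun_def intro!: nn_integral_mono)
  have "(\<integral>\<^sup>+s. (SUP i. U i s) \<partial>weighted_sum_measure I c \<mu>) =
      (SUP i. \<integral>\<^sup>+v. c v * (\<integral>\<^sup>+s. U i s \<partial>\<mu> v) \<partial>count_space I)"
    using seq by (simp add: nn_integral_monotone_convergence_SUP)
  also have "\<dots> = (\<integral>\<^sup>+v. (SUP i. c v * (\<integral>\<^sup>+s. U i s \<partial>\<mu> v)) \<partial>count_space I)"
    using inc by (intro nn_integral_monotone_convergence_SUP[symmetric])
      (auto simp: incseq_def le_fun_def intro!: mult_left_mono)
  also have "\<dots> = (\<integral>\<^sup>+v. c v * (\<integral>\<^sup>+s. (SUP i. U i s) \<partial>\<mu> v) \<partial>count_space I)"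
    using seq sets by (intro nn_integral_cong)
      (simp add: nn_integral_monotone_convergence_SUP measurable_cong_sets[OF sets refl] SUP_mult_left_ennreal)
  finally show ?case by (simp add: image_comp)
qed

section \<open>Determinacy and backward extension of moment sequences\<close>

text \<open>On the half-line all powers are nonnegative, so moments can be computed in
  \<open>ennreal\<close>, where no integrability has to be carried along. The clause
  \<open>0 \<le> t n\<close> is stated separately because \<open>ennreal\<close> sends negative
  reals to 0.\<close>

lemma stieltjes_represents_iff_nn_integral:
  "stieltjes_represents M t \<longleftrightarrow> sets M = sets borel \<and> emeasure M (- {0..}) = 0 \<and>
    (\<forall>n. 0 \<le> t n \<and> (\<integral>\<^sup>+s. ennreal s ^ n \<partial>M) = ennreal (t n))"
proof (cases "sets M = sets borel \<and> emeasure M (- {0..}) = 0")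
  case True
  then have [measurable_cong]: "sets M = sets borel" and null: "emeasure M (- {0..}) = 0"
    by auto
  have pos: "AE s in M. 0 \<le> s"
    by (rule AE_I[OF _ null]) auto
  have eq: "(\<integral>\<^sup>+s. ennreal s ^ n \<partial>M) = (\<integral>\<^sup>+s. ennreal (s ^ n) \<partial>M)" for n
    by (rule nn_integral_cong_AE) (use pos in \<open>auto simp: ennreal_power\<close>)
  have powpos: "AE s in M. 0 \<le> s ^ n" for n
    using pos by eventually_elim simp
  have "integrable M (\<lambda>s. s ^ n) \<and> t n = (\<integral>s. s ^ n \<partial>M) \<longleftrightarrow>
      0 \<le> t n \<and> (\<integral>\<^sup>+s. ennreal s ^ n \<partial>M) = ennreal (t n)" for n
  proof (cases "0 \<le> t n")
    case True
    have "(\<lambda>s. s ^ n) \<in> borel_measurable M" by measurable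
    from nn_integral_eq_integrable[OF this powpos True] True show ?thesis
      unfolding eq by metis
  next
    case False
    then show ?thesis
      using integral_nonneg_AE[OF powpos[of n]] by metis
  qed
  then show ?thesis
    using True unfolding stieltjes_represents_def by blast
qed (auto simp: stieltjes_represents_def)

lemma stieltjes_represents_finite_measure:
  assumes "stieltjes_represents M t"
  shows "finite_measure M"
proof (rule finite_measureI)
  have "(\<integral>\<^sup>+s. ennreal s ^ 0 \<partial>M) = ennreal (t 0)"
    using assms unfolding stieltjes_represents_iff_nn_integral by blast
  then show "emeasure M (space M) \<noteq> \<infinity>" by simp
qed

text \<open>Markov's inequality for the n-th power bounds the mass of \<open>{r..}\<close> by
  \<open>K * (R / r) ^ n\<close>, which tends to 0 when \<open>R < r\<close>.\<close>

lemma stieltjes_represents_AE_bounded: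
  assumes M: "stieltjes_represents M t" and bound: "\<And>n. t n \<le> K * R ^ n" and R: "0 \<le> R"
  shows "AE s in M. s \<in> {0..R}"
proof -
  have sets [measurable_cong]: "sets M = sets borel" and null: "emeasure M (- {0..}) = 0"
    and int: "integrable M (\<lambda>s. s ^ n)" and t: "t n = (\<integral>s. s ^ n \<partial>M)" for n
    using M by (auto simp: stieltjes_represents_def)
  interpret finite_measure M
    by (rule stieltjes_represents_finite_measure[OF M])
  have pos: "AE s in M. 0 \<le> s"
    by (rule AE_I[OF _ null]) auto
  have zero: "emeasure M {r..} = 0" if "R < r" for r
  proof -
    have le: "measure M {r..} \<le> K * (R / r) ^ n" for n
    proof -
      have "r ^ n * measure M {r..} = (\<integral>s. r ^ n * indicator {r..} s \<partial>M)"
        by simp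
      also have "\<dots> \<le> (\<integral>s. s ^ n \<partial>M)"
      proof (rule integral_mono_AE)
        show "integrable M (\<lambda>s. r ^ n * indicator {r..} s)"
          by (intro integrable_mult_right integrable_const_bound[where B = 1]) (auto split: split_indicator)
        show "AE s in M. r ^ n * indicator {r..} s \<le> s ^ n"
          using pos by eventually_elim (use that R in \<open>auto split: split_indicator intro: power_mono\<close>)
      qed (rule int)
      also have "\<dots> \<le> K * R ^ n" using bound t by simp
      finally show ?thesis
        using that R by (simp add: power_divide field_simps)
    qed
    have "(\<lambda>n. (R / r) ^ n) \<longlonglongrightarrow> 0"
      using that R by (intro LIMSEQ_realpow_zero) auto
    then have "(\<lambda>n. K * (R / r) ^ n) \<longlonglongrightarrow> 0"
      using tendsto_mult_right_zero by blast
    then have "measure M {r..} \<le> 0"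
      using le by (intro LIMSEQ_le_const) auto
    then show ?thesis
      by (simp add: emeasure_eq_measure measure_le_0_iff)
  qed
  have "{R<..} = (\<Union>k. {R + 1 / real (Suc k)..})"
  proof safe
    fix x assume "R < x"
    then obtain k where "1 / real (Suc k) < x - R"
      using reals_Archimedean[of "x - R"] by (auto simp: inverse_eq_divide)
    then show "x \<in> (\<Union>k. {R + 1 / real (Suc k)..})"
      by (intro UN_I[of k]) auto
  next
    fix x k assume "R + 1 / real (Suc k) \<le> x"
    moreover have "0 < 1 / real (Suc k)" by simp
    ultimately show "R < x" by linarith
  qed
  moreover have "emeasure M (\<Union>k. {R + 1 / real (Suc k)..}) = 0"
    by (rule emeasure_UN_eq_0) (auto intro!: zero)
  ultimately have "AE s in M. s \<le> R"
    by (intro AE_I[where N = "{R<..}"]) auto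
  with pos show ?thesis by eventually_elim auto
qed

text \<open>The moments fix the integrals of polynomials. Both measures live on
  \<open>{0..R}\<close>, so uniform approximation there fixes the integrals of bounded continuous
  functions, hence the masses of open rays, hence the measure.\<close>

lemma stieltjes_determinate:
  assumes M: "stieltjes_represents M t" and N: "stieltjes_represents N t"
    and bound: "\<And>n. t n \<le> K * R ^ n" and R: "0 \<le> R"
  shows "M = N"
proof -
  \<comment> \<open>The polynomial integrates to the same number for every representing measure, and
    the error is controlled by the common total mass \<open>t 0\<close>. The bound on
    \<open>f\<close> off \<open>{0..R}\<close> serves integrability.\<close>
  have approx: "\<bar>(\<integral>s. f s \<partial>L) - (\<Sum>i\<le>n. a i * t i)\<bar> \<le> e * t 0"
    if L: "stieltjes_represents L t" and f: "f \<in> borel_measurable borel" "\<And>s. \<bar>f s\<bar> \<le> 1"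
      and le: "\<And>s. s \<in> {0..R} \<Longrightarrow> \<bar>f s - (\<Sum>i\<le>n. a i * s ^ i)\<bar> \<le> e"
    for L f a n e
  proof -
    have sets [measurable_cong]: "sets L = sets borel"
      and int: "\<And>n. integrable L (\<lambda>s. s ^ n)" and t: "\<And>n. t n = (\<integral>s. s ^ n \<partial>L)"
      using L by (auto simp: stieltjes_represents_def)
    interpret finite_measure L by (rule stieltjes_represents_finite_measure[OF L])
    have intf: "integrable L f"
      using f by (intro integrable_const_bound[where B = 1]) auto
    have "(\<integral>s. f s \<partial>L) - (\<Sum>i\<le>n. a i * t i) = (\<integral>s. f s - (\<Sum>i\<le>n. a i * s ^ i) \<partial>L)"
      using int intf by (simp add: t)
    moreover have "\<bar>\<integral>s. f s - (\<Sum>i\<le>n. a i * s ^ i) \<partial>L\<bar> \<le> (\<integral>s. e \<partial>L)"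
    proof (rule order_trans[OF integral_abs_bound integral_mono_AE])
      show "AE s in L. \<bar>f s - (\<Sum>i\<le>n. a i * s ^ i)\<bar> \<le> e"
        using stieltjes_represents_AE_bounded[OF L bound R] by eventually_elim (rule le)
    qed (use int intf in auto)
    moreover have "measure L (space L) = t 0"
      by (simp add: t)
    ultimately show ?thesis by (simp add: mult.commute)
  qed
  have cont: "(\<integral>s. f s \<partial>M) = (\<integral>s. f s \<partial>N)"
    if f: "continuous_on UNIV f" "\<And>s. \<bar>f s\<bar> \<le> 1" for f :: "real \<Rightarrow> real"
  proof -
    have fm: "f \<in> borel_measurable borel"
      using f(1) by (rule borel_measurable_continuous_onI)
    have "\<bar>(\<integral>s. f s \<partial>M) - (\<integral>s. f s \<partial>N)\<bar> \<le> 0 + e" if "0 < e" for e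
    proof -
      have t0: "0 \<le> t 0"
        using M by (simp add: stieltjes_represents_iff_nn_integral)
      \<comment> \<open>Each of the two approximations then costs at most \<open>e / 2\<close>;
        adding 1 keeps the denominator positive when \<open>t 0\<close> is 0.\<close>
      define d where "d = e / 2 / (t 0 + 1)"
      have d: "0 < d" using t0 that by (simp add: d_def)
      have "d * t 0 \<le> d * (t 0 + 1)" using d by (intro mult_left_mono) auto
      also have "\<dots> = e / 2" using t0 unfolding d_def by (intro nonzero_eq_divide_eq[THEN iffD1] refl) auto
      finally have dt: "d * t 0 \<le> e / 2" .
      obtain g where "real_polynomial_function g" and g: "\<And>x. x \<in> {0..R} \<Longrightarrow> \<bar>f x - g x\<bar> < d"
        using Stone_Weierstrass_real_polynomial_function[OF compact_Icc
            continuous_on_subset[OF f(1) subset_UNIV] d] by blast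
      then obtain a n where an: "g = (\<lambda>x. \<Sum>i\<le>n. a i * x ^ i)"
        by (auto simp: real_polynomial_function_iff_sum)
      have le: "\<bar>f s - (\<Sum>i\<le>n. a i * s ^ i)\<bar> \<le> d" if "s \<in> {0..R}" for s
        using g[OF that] by (simp add: an)
      show ?thesis
        using approx[OF M fm f(2) le] approx[OF N fm f(2) le] dt by linarith
    qed
    then have "\<bar>(\<integral>s. f s \<partial>M) - (\<integral>s. f s \<partial>N)\<bar> \<le> 0"
      by (rule field_le_epsilon)
    then show ?thesis by simp
  qed
  \<comment> \<open>Continuous functions with values in [0,1] that vanish up to and including
    \<open>x\<close> and converge pointwise to the indicator of the open ray
    \<open>{x<..}\<close>.\<close>
  define ramp where "ramp x n s = min 1 (max 0 (real n * (s - x)))" for x n and s :: real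
  have lim: "(\<lambda>n. \<integral>s. ramp x n s \<partial>L) \<longlonglongrightarrow> measure L {x<..}"
    if L: "stieltjes_represents L t" for L x
  proof -
    have sets [measurable_cong]: "sets L = sets borel"
      using L by (auto simp: stieltjes_represents_def)
    interpret finite_measure L by (rule stieltjes_represents_finite_measure[OF L])
    have "(\<lambda>n. \<integral>s. ramp x n s \<partial>L) \<longlonglongrightarrow> (\<integral>s. indicator {x<..} s \<partial>L)"
    proof (rule integral_dominated_convergence[where w = "\<lambda>_. 1"])
      show "AE s in L. (\<lambda>n. ramp x n s) \<longlonglongrightarrow> indicator {x<..} s"
      proof (rule AE_I2)
        fix s
        show "(\<lambda>n. ramp x n s) \<longlonglongrightarrow> indicator {x<..} s"
        proof (cases "x < s")
          case True
          obtain k where k: "1 < real k * (s - x)"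
            using reals_Archimedean3[of "s - x"] True by auto
          have "ramp x n s = 1" if "k \<le> n" for n
          proof -
            have "real k * (s - x) \<le> real n * (s - x)"
              using that True by (intro mult_right_mono) auto
            then show ?thesis using k by (simp add: ramp_def)
          qed
          then have "eventually (\<lambda>n. ramp x n s = 1) sequentially"
            by (auto simp: eventually_sequentially)
          then show ?thesis using True by (simp add: tendsto_eventually)
        next
          case False
          then have "ramp x n s = 0" for n
            by (simp add: ramp_def mult_nonneg_nonpos)
          then show ?thesis using False by simp
        qed
      qed
    qed (auto simp: ramp_def)
    then show ?thesis using sets_eq_imp_space_eq[OF sets] by simp
  qed
  have meas: "measure M {x<..} = measure N {x<..}" for x
  proof (rule LIMSEQ_unique[OF lim[OF M]])
    have "(\<integral>s. ramp x n s \<partial>M) = (\<integral>s. ramp x n s \<partial>N)" for n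
      unfolding ramp_def by (intro cont continuous_intros) auto
    then show "(\<lambda>n. \<integral>s. ramp x n s \<partial>M) \<longlonglongrightarrow> measure N {x<..}"
      using lim[OF N] by simp
  qed
  interpret M: finite_measure M by (rule stieltjes_represents_finite_measure[OF M])
  interpret N: finite_measure N by (rule stieltjes_represents_finite_measure[OF N])
  show ?thesis
  proof (rule measure_eqI_lessThan)
    show "sets M = sets borel" "sets N = sets borel"
      using M N by (simp_all add: stieltjes_represents_def)
    fix x
    show "emeasure M {x<..} < \<infinity>"
      by (simp add: M.emeasure_eq_measure)
    show "emeasure M {x<..} = emeasure N {x<..}"
      by (simp only: M.emeasure_eq_measure N.emeasure_eq_measure meas)
  qed
qed

text \<open>The measures \<open>P\<close> and \<open>s dN(s)\<close> have the same moments, so they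
  coincide by determinacy. Dividing by \<open>s\<close> gives back \<open>N\<close> on the positive
  axis, and the density \<open>s\<close> removes any atom at 0.\<close>

lemma recip_integral_shifted:
  assumes N: "stieltjes_represents N t" and P: "stieltjes_represents P (\<lambda>n. t (Suc n))"
    and bound: "\<And>n. t n \<le> K * R ^ n" and R: "0 \<le> R"
  shows "\<sigma> \<in> sets borel \<Longrightarrow> recip_integral P \<sigma> = emeasure N (\<sigma> \<inter> {0<..})"
    and "emeasure P {0} = 0"
proof -
  have sets [measurable_cong]: "sets N = sets borel"
    and nn: "0 \<le> t n" and t: "(\<integral>\<^sup>+s. ennreal s ^ n \<partial>N) = ennreal (t n)" for n
    using N by (auto simp: stieltjes_represents_iff_nn_integral)
  \<comment> \<open>As a density, \<open>ennreal\<close> is the positive part of \<open>s\<close>,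
    so the new measure puts no mass on the negative axis.\<close>
  have "stieltjes_represents (density N ennreal) (\<lambda>n. t (Suc n))"
    unfolding stieltjes_represents_iff_nn_integral
  proof (intro conjI allI)
    have "emeasure (density N ennreal) (- {0..}) = (\<integral>\<^sup>+s. ennreal s * indicator (- {0..}) s \<partial>N)"
      by (intro emeasure_density) measurable
    also have "\<dots> = (\<integral>\<^sup>+s. 0 \<partial>N)"
      by (intro nn_integral_cong) (auto simp: ennreal_neg split: split_indicator)
    finally show "emeasure (density N ennreal) (- {0..}) = 0" by simp
    show "(\<integral>\<^sup>+s. ennreal s ^ n \<partial>density N ennreal) = ennreal (t (Suc n))" for n
      using t[of "Suc n"] by (simp add: nn_integral_density)
  qed (simp_all add: sets nn)
  moreover have "t (Suc n) \<le> (K * R) * R ^ n" for n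
    using bound[of "Suc n"] by (simp add: mult_ac)
  ultimately have PN: "P = density N ennreal"
    using stieltjes_determinate[OF P] R by blast
  show "recip_integral P \<sigma> = emeasure N (\<sigma> \<inter> {0<..})" if [measurable]: "\<sigma> \<in> sets borel"
  proof -
    have "recip_integral P \<sigma> = (\<integral>\<^sup>+s. ennreal s * (1 / ennreal s * indicator (\<sigma> \<inter> {0..}) s) \<partial>N)"
      unfolding recip_integral_def PN by (intro nn_integral_density) measurable
    also have "\<dots> = (\<integral>\<^sup>+s. indicator (\<sigma> \<inter> {0<..}) s \<partial>N)"
    proof (intro nn_integral_cong)
      \<comment> \<open>At \<open>s = 0\<close> the convention that 0 times infinity is 0 decides:
        the point 0 drops out, so the right side has the open ray \<open>{0<..}\<close>.\<close>
      fix s :: real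
      show "ennreal s * (1 / ennreal s * indicator (\<sigma> \<inter> {0..}) s) = indicator (\<sigma> \<inter> {0<..}) s"
        by (cases "0 < s") (auto simp: ennreal_times_divide ennreal_neg split: split_indicator)
    qed
    also have "\<dots> = emeasure N (\<sigma> \<inter> {0<..})"
      using that by (intro nn_integral_indicator) (simp add: sets)
    finally show ?thesis .
  qed
  have "emeasure P {0} = (\<integral>\<^sup>+s. ennreal s * indicator {0} s \<partial>N)"
    unfolding PN by (intro emeasure_density) measurable
  also have "\<dots> = (\<integral>\<^sup>+s. 0 \<partial>N)"
    by (intro nn_integral_cong) (auto split: split_indicator)
  finally show "emeasure P {0} = 0" by simp
qed

text \<open>The measure \<open>dP(s) / s\<close> has the right moments of positive order. An atom at
  0 changes the moment of order 0 only, and supplies the missing mass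
  \<open>t 0 - \<integral> 1/s dP(s)\<close>.\<close>

lemma stieltjes_moment_sequence_backward_extension:
  assumes P: "stieltjes_represents P (\<lambda>n. t (Suc n))"
    and t0: "0 \<le> t 0" and le: "recip_integral P {0..} \<le> ennreal (t 0)"
  shows "stieltjes_moment_sequence t"
proof -
  have sets [measurable_cong]: "sets P = sets borel" and null: "emeasure P (- {0..}) = 0"
    and nn: "0 \<le> t (Suc n)" and t: "(\<integral>\<^sup>+s. ennreal s ^ n \<partial>P) = ennreal (t (Suc n))" for n
    using P by (auto simp: stieltjes_represents_iff_nn_integral)
  define a where "a = recip_integral P {0..}"
  define h where "h s = 1 / ennreal s * indicator {0..} s" for s
  have h [measurable]: "h \<in> borel_measurable borel"
    unfolding h_def by measurable
  have a: "a = (\<integral>\<^sup>+s. h s \<partial>P)"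
    by (simp add: a_def recip_integral_def h_def)
  \<comment> \<open>Adding two measures is a weighted sum over the index type \<open>bool\<close>:
    \<open>True\<close> carries \<open>dP(s) / s\<close>, \<open>False\<close> the atom at
    0.\<close>
  define c where "c b = (if b then 1 else ennreal (t 0) - a)" for b
  define \<nu> where "\<nu> b = (if b then density P h else return borel (0::real))" for b
  define N where "N = weighted_sum_measure UNIV c \<nu>"
  have int: "(\<integral>\<^sup>+s. f s \<partial>N) = (\<integral>\<^sup>+s. h s * f s \<partial>P) + (ennreal (t 0) - a) * f 0"
    if [measurable]: "f \<in> borel_measurable borel" for f
  proof -
    have "(\<integral>\<^sup>+s. f s \<partial>N) = (\<integral>\<^sup>+b. c b * (\<integral>\<^sup>+s. f s \<partial>\<nu> b) \<partial>count_space UNIV)"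
      unfolding N_def by (rule nn_integral_weighted_sum_measure) (simp_all add: \<nu>_def sets)
    also have "\<dots> = (\<integral>\<^sup>+s. h s * f s \<partial>P) + (ennreal (t 0) - a) * f 0"
      by (simp add: nn_integral_count_space_finite UNIV_bool c_def \<nu>_def nn_integral_density
          nn_integral_return add.commute)
    finally show ?thesis .
  qed
  \<comment> \<open>Since \<open>h\<close> is infinite at 0 and has finite integral,
    \<open>P\<close> has no atom there.\<close>
  have pos: "AE s in P. 0 < s"
  proof -
    have "AE s in P. h s \<noteq> \<infinity>"
      using le by (intro nn_integral_PInf_AE) (auto simp: a_def[symmetric] a[symmetric] top_unique)
    moreover have "AE s in P. 0 \<le> s"
      by (rule AE_I[OF _ null]) auto
    ultimately show ?thesis
    proof eventually_elim
      case (elim s)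
      then show ?case by (cases "s = 0") (auto simp: h_def)
    qed
  qed
  have "stieltjes_represents N t"
    unfolding stieltjes_represents_iff_nn_integral
  proof (intro conjI allI)
    show sN: "sets N = sets borel"
      by (simp add: N_def)
    have "emeasure N (- {0..}) = (\<integral>\<^sup>+s. indicator (- {0..}) s \<partial>N)"
      by (rule nn_integral_indicator[symmetric]) (simp add: sN)
    also have "\<dots> = (\<integral>\<^sup>+s. h s * indicator (- {0..}) s \<partial>P)"
      by (subst int) auto
    also have "\<dots> = (\<integral>\<^sup>+s. 0 \<partial>P)"
      by (intro nn_integral_cong) (auto simp: h_def split: split_indicator)
    finally show "emeasure N (- {0..}) = 0" by simp
    fix n
    show "0 \<le> t n"
      using t0 nn by (cases n) auto
    show "(\<integral>\<^sup>+s. ennreal s ^ n \<partial>N) = ennreal (t n)"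
    proof (cases n)
      case 0
      have "(\<integral>\<^sup>+s. 1 \<partial>N) = a + (ennreal (t 0) - a)"
        using int[OF borel_measurable_const, of 1] by (simp only: a mult_1_right)
      \<comment> \<open>Subtraction in \<open>ennreal\<close> is truncated; \<open>le\<close>
        ensures that the two masses really add up to \<open>t 0\<close>.\<close>
      also have "\<dots> = ennreal (t 0)"
        using le unfolding a_def by (rule add_diff_inverse_ennreal)
      finally show ?thesis by (simp only: 0 power_0)
    next
      case (Suc m)
      have "(\<integral>\<^sup>+s. ennreal s ^ n \<partial>N) = (\<integral>\<^sup>+s. h s * ennreal s ^ n \<partial>P)"
        by (simp add: int Suc)
      also have "\<dots> = (\<integral>\<^sup>+s. ennreal s ^ m \<partial>P)"
      proof (rule nn_integral_cong_AE, use pos in eventually_elim)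
        case (elim s)
        then have "h s * ennreal s = 1"
          by (simp add: h_def ennreal_divide_times)
        then show ?case by (simp add: Suc mult.assoc[symmetric])
      qed
      finally show ?thesis by (simp add: t Suc)
    qed
  qed
  then show ?thesis
    unfolding stieltjes_moment_sequence_def by blast
qed

section \<open>Moments of weighted shifts\<close>

lemma directed_tree_edge:
  assumes "directed_tree V E" "(p, v) \<in> E"
  shows "v \<in> nonroots V E" "par E v = p"
proof -
  have v: "v \<in> V" "\<not> is_root V E v"
    using assms by (auto simp: directed_tree_def is_root_def)
  then have "\<exists>!p. (p, v) \<in> E"
    using assms(1) by (auto simp: directed_tree_def)
  then show "par E v = p"
    unfolding par_def using assms(2) by (rule the1_equality)
  show "v \<in> nonroots V E"
    using v by (simp add: nonroots_def)
qed

text \<open>Translates children into \<open>nonroots\<close> and \<open>par\<close>, the terms in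
  which \<open>wshift\<close> is defined.\<close>

lemma Chi_iff:
  assumes "directed_tree V E"
  shows "v \<in> Chi V E u \<longleftrightarrow> v \<in> nonroots V E \<and> par E v = u"
proof
  assume "v \<in> Chi V E u"
  then show "v \<in> nonroots V E \<and> par E v = u"
    using directed_tree_edge[OF assms] by (auto simp: Chi_def)
next
  assume v: "v \<in> nonroots V E \<and> par E v = u"
  then obtain p where "(p, v) \<in> E" "v \<in> V"
    by (auto simp: nonroots_def is_root_def)
  with v show "v \<in> Chi V E u"
    using directed_tree_edge[OF assms] by (auto simp: Chi_def)
qed

text \<open>The product of the weights met on climbing \<open>n\<close> generations from
  \<open>x\<close>. It is 0 if the climb would have to pass beyond the root, matching the value 0 of
  the shift there.\<close>

primrec path_weight :: "'a set \<Rightarrow> ('a \<times> 'a) set \<Rightarrow> ('a \<Rightarrow> complex) \<Rightarrow> nat \<Rightarrow> 'a \<Rightarrow> complex" where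
  "path_weight V E lam 0 x = 1"
| "path_weight V E lam (Suc n) x =
    (if x \<in> nonroots V E then lam x * path_weight V E lam n (par E x) else 0)"

text \<open>Where the n-th ancestor does not exist, \<open>par\<close> yields an unspecified vertex,
  but the factor \<open>path_weight\<close> is then 0.\<close>

lemma wshift_funpow:
  "(wshift V E lam ^^ n) f x = path_weight V E lam n x * f ((par E ^^ n) x)"
proof (induction n arbitrary: x)
  case (Suc n)
  have "(wshift V E lam ^^ Suc n) f x = wshift V E lam ((wshift V E lam ^^ n) f) x"
    by simp
  also have "\<dots> = path_weight V E lam (Suc n) x * f ((par E ^^ n) (par E x))"
    by (simp add: wshift_def[of V E lam "(wshift V E lam ^^ n) f"] Suc)
  finally show ?case
    by (simp only: funpow_Suc_right o_apply)
qed simp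

section \<open>Basis vectors, norms and growth of the moments\<close>

lemma indicator_in_l2:
  assumes "w \<in> V"
  shows "indicator {w} \<in> l2 V"
proof -
  let ?g = "\<lambda>x. (cmod (indicator {w} x))\<^sup>2"
  have "?g summable_on {w}" by simp
  then have "?g summable_on V"
    by (rule summable_on_cong_neutral[THEN iffD1, rotated -1]) (use assms in auto)
  then show ?thesis
    using assms by (auto simp: l2_def split: split_indicator)
qed

text \<open>Vectors in \<open>l2 V\<close> vanish off \<open>V\<close>, so the squared norm may be
  computed over the whole type; this gives all vectors one index set for the later exchange of
  sums.\<close>

lemma ennreal_l2_norm_sq:
  assumes "f \<in> l2 V"
  shows "ennreal ((l2_norm V f)\<^sup>2) = (\<integral>\<^sup>+x. ennreal ((cmod (f x))\<^sup>2) \<partial>count_space UNIV)"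
proof -
  let ?g = "\<lambda>x. (cmod (f x))\<^sup>2"
  have "ennreal ((l2_norm V f)\<^sup>2) = ennreal (infsum ?g V)"
    by (simp add: l2_norm_def infsum_nonneg)
  also have "\<dots> = (SUP F\<in>{F. finite F \<and> F \<subseteq> V}. ennreal (sum ?g F))"
    using assms by (intro infsum_nonneg_is_SUPREMUM_ennreal) (auto simp: l2_def)
  also have "\<dots> = infsum (\<lambda>x. ennreal (?g x)) V"
    by (simp add: nonneg_infsum_complete sum_ennreal)
  also have "\<dots> = (\<integral>\<^sup>+x. ennreal (?g x) \<partial>count_space V)"
    by (rule infsum_eq_nn_integral_count_space)
  also have "\<dots> = (\<integral>\<^sup>+x. ennreal (?g x) \<partial>count_space UNIV)"
    using assms by (intro nn_integral_count_space_eq) (auto simp: l2_def)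
  finally show ?thesis .
qed

lemma l2_bounded_operator_funpow_mem:
  assumes "l2_bounded_operator V D T" "f \<in> l2 V"
  shows "(T ^^ n) f \<in> l2 V"
  using assms by (induction n) (auto simp: l2_bounded_operator_def)

lemma wshift_moments_nonneg: "0 \<le> wshift_moments V E lam w n"
  by (simp add: wshift_moments_def)

lemma wshift_moments_0:
  assumes "w \<in> V"
  shows "wshift_moments V E lam w 0 = 1"
proof -
  have "ennreal (wshift_moments V E lam w 0) =
      (\<integral>\<^sup>+x. ennreal ((cmod (indicator {w} x))\<^sup>2) \<partial>count_space UNIV)"
    using ennreal_l2_norm_sq[OF indicator_in_l2[OF assms]] by (simp add: wshift_moments_def)
  also have "\<dots> = (\<integral>\<^sup>+x. indicator {w} x \<partial>count_space UNIV)"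
    by (intro nn_integral_cong) (auto split: split_indicator)
  also have "\<dots> = 1" by simp
  finally show ?thesis by simp
qed

text \<open>Basis vectors have norm 1, so iterating the operator bound \<open>C\<close> gives
  \<open>R = C\<^sup>2\<close>, the same for all vertices.\<close>

lemma wshift_moments_bounded:
  assumes T: "l2_bounded_operator V (wshift_domain V E lam) (wshift V E lam)"
  obtains R where "0 \<le> R" "\<And>w n. w \<in> V \<Longrightarrow> wshift_moments V E lam w n \<le> R ^ n"
proof -
  let ?T = "wshift V E lam"
  obtain C where C: "\<And>f. f \<in> l2 V \<Longrightarrow> l2_norm V (?T f) \<le> C * l2_norm V f"
    using T unfolding l2_bounded_operator_def by metis
  have nn: "0 \<le> l2_norm V f" for f :: "'a \<Rightarrow> complex"
    by (simp add: l2_norm_def infsum_nonneg)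
  have "wshift_moments V E lam w n \<le> (C\<^sup>2) ^ n" if "w \<in> V" for w n
  proof (induction n)
    case (Suc n)
    let ?f = "(?T ^^ n) (indicator {w})"
    have "l2_norm V (?T ?f) \<le> C * l2_norm V ?f"
      by (intro C l2_bounded_operator_funpow_mem[OF T] indicator_in_l2 that)
    then have "(l2_norm V (?T ?f))\<^sup>2 \<le> (C * l2_norm V ?f)\<^sup>2"
      by (intro power_mono nn)
    also have "\<dots> \<le> C\<^sup>2 * (C\<^sup>2) ^ n"
      using Suc by (simp add: power_mult_distrib wshift_moments_def mult_left_mono)
    finally show ?case by (simp add: wshift_moments_def)
  qed (simp add: wshift_moments_0[OF that])
  then show thesis by (intro that[of "C\<^sup>2"]) auto
qed

text \<open>The vectors \<open>S^n e_v\<close> for different children \<open>v\<close> of \<open>u\<close> have disjoint supports.\<close>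

lemma wshift_moments_Suc:
  assumes tree: "directed_tree V E"
    and T: "l2_bounded_operator V (wshift_domain V E lam) (wshift V E lam)" and u: "u \<in> V"
  shows "ennreal (wshift_moments V E lam u (Suc n)) =
    (\<integral>\<^sup>+v. ennreal ((cmod (lam v))\<^sup>2) * ennreal (wshift_moments V E lam v n) \<partial>count_space (Chi V E u))"
proof -
  let ?T = "wshift V E lam" and ?C = "Chi V E u"
  have moment: "ennreal (wshift_moments V E lam w n) =
      (\<integral>\<^sup>+x. ennreal ((cmod ((?T ^^ n) (indicator {w}) x))\<^sup>2) \<partial>count_space UNIV)"
    if "w \<in> V" for w n
    unfolding wshift_moments_def
    by (intro ennreal_l2_norm_sq l2_bounded_operator_funpow_mem[OF T] indicator_in_l2 that)
  \<comment> \<open>The contribution of the child \<open>v\<close> at the point \<open>x\<close>.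
    The indicator of the set of children lets \<open>v\<close> range over the whole type.\<close>
  define g where "g x v = indicator ?C v *
      (ennreal ((cmod (lam v))\<^sup>2) * ennreal ((cmod ((?T ^^ n) (indicator {v}) x))\<^sup>2))" for x v
  have split: "ennreal ((cmod ((?T ^^ Suc n) (indicator {u}) x))\<^sup>2) = (\<integral>\<^sup>+v. g x v \<partial>count_space UNIV)"
    for x
  proof -
    \<comment> \<open>For fixed \<open>x\<close> only the n-th ancestor \<open>y\<close> can
      contribute, which turns the square of a sum into a sum of squares.\<close>
    define y where "y = (par E ^^ n) x"
    have "(?T ^^ Suc n) (indicator {u}) x = (?T ^^ n) (?T (indicator {u})) x"
      by (simp add: funpow_swap1)
    also have "\<dots> = path_weight V E lam n x * (indicator ?C y * lam y)"
      unfolding wshift_funpow[of n] by (auto simp: y_def wshift_def Chi_iff[OF tree] split: split_indicator)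
    finally have "ennreal ((cmod ((?T ^^ Suc n) (indicator {u}) x))\<^sup>2) = g x y"
      by (auto simp: g_def wshift_funpow y_def norm_mult power_mult_distrib ennreal_mult' mult_ac split: split_indicator)
    also have "\<dots> = (\<integral>\<^sup>+v. g x y * indicator {y} v \<partial>count_space UNIV)"
      by simp
    also have "\<dots> = (\<integral>\<^sup>+v. g x v \<partial>count_space UNIV)"
      by (intro nn_integral_cong) (auto simp: g_def wshift_funpow y_def split: split_indicator)
    finally show ?thesis .
  qed
  have "ennreal (wshift_moments V E lam u (Suc n)) =
      (\<integral>\<^sup>+x. \<integral>\<^sup>+v. g x v \<partial>count_space UNIV \<partial>count_space UNIV)"
    unfolding moment[OF u] split ..
  \<comment> \<open>Tonelli for counting measures, applied through the integral over pairs.\<close>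
  also have "\<dots> = (\<integral>\<^sup>+v. \<integral>\<^sup>+x. g x v \<partial>count_space UNIV \<partial>count_space UNIV)"
    using nn_integral_fst_count_space[of "case_prod g"] nn_integral_snd_count_space[of "case_prod g"]
    by simp
  also have "\<dots> = (\<integral>\<^sup>+v. (ennreal ((cmod (lam v))\<^sup>2) * ennreal (wshift_moments V E lam v n)) *
      indicator ?C v \<partial>count_space UNIV)"
  proof (intro nn_integral_cong)
    fix v
    show "(\<integral>\<^sup>+x. g x v \<partial>count_space UNIV) =
      (ennreal ((cmod (lam v))\<^sup>2) * ennreal (wshift_moments V E lam v n)) * indicator ?C v"
    proof (cases "v \<in> ?C")
      case True
      then have "v \<in> V" by (simp add: Chi_def)
      then show ?thesis
        using True by (simp add: g_def moment nn_integral_cmult)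
    qed (simp add: g_def)
  qed
  also have "\<dots> = (\<integral>\<^sup>+v. ennreal ((cmod (lam v))\<^sup>2) * ennreal (wshift_moments V E lam v n) \<partial>count_space ?C)"
    by (simp add: nn_integral_count_space_indicator)
  finally show ?thesis .
qed

section \<open>Passing from the measures of the children to that of \<open>u\<close>\<close>

lemma consistency_sum_eq_recip_integral:
  assumes sets: "\<And>v. v \<in> Chi V E u \<Longrightarrow> sets (\<mu> v) = sets borel" and [measurable]: "\<sigma> \<in> sets borel"
  shows "consistency_sum V E lam \<mu> u \<sigma> =
    recip_integral (weighted_sum_measure (Chi V E u) (\<lambda>v. ennreal ((cmod (lam v))\<^sup>2)) \<mu>) \<sigma>"
  unfolding consistency_sum_def infsum_eq_nn_integral_count_space recip_integral_def
  by (rule nn_integral_weighted_sum_measure[symmetric]) (use sets in auto)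

text \<open>Moments are linear in the measure, and the weights \<open>|\<lambda>_v|^2\<close> are
  those of the recursion \<open>wshift_moments_Suc\<close>.\<close>

lemma stieltjes_represents_weighted_sum_measure:
  assumes tree: "directed_tree V E"
    and T: "l2_bounded_operator V (wshift_domain V E lam) (wshift V E lam)" and u: "u \<in> V"
    and \<mu>: "\<And>v. v \<in> Chi V E u \<Longrightarrow> stieltjes_represents (\<mu> v) (wshift_moments V E lam v)"
  shows "stieltjes_represents
    (weighted_sum_measure (Chi V E u) (\<lambda>v. ennreal ((cmod (lam v))\<^sup>2)) \<mu>)
    (\<lambda>n. wshift_moments V E lam u (Suc n))"
    (is "stieltjes_represents ?P _")
  unfolding stieltjes_represents_iff_nn_integral
proof (intro conjI allI)
  have sets: "sets (\<mu> v) = sets borel" and null: "emeasure (\<mu> v) (- {0..}) = 0"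
    and mom: "(\<integral>\<^sup>+s. ennreal s ^ n \<partial>\<mu> v) = ennreal (wshift_moments V E lam v n)"
    if "v \<in> Chi V E u" for v n
    using \<mu>[OF that] by (auto simp: stieltjes_represents_iff_nn_integral)
  show "sets ?P = sets borel" by simp
  have "emeasure ?P (- {0..}) =
      (\<integral>\<^sup>+v. ennreal ((cmod (lam v))\<^sup>2) * emeasure (\<mu> v) (- {0..}) \<partial>count_space (Chi V E u))"
    by (rule emeasure_weighted_sum_measure) (use sets in auto)
  also have "\<dots> = (\<integral>\<^sup>+v. 0 \<partial>count_space (Chi V E u))"
    by (intro nn_integral_cong) (simp only: null space_count_space mult_zero_right)
  finally show "emeasure ?P (- {0..}) = 0" by simp
  fix n
  show "0 \<le> wshift_moments V E lam u (Suc n)"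
    by (rule wshift_moments_nonneg)
  have "(\<integral>\<^sup>+s. ennreal s ^ n \<partial>?P) =
      (\<integral>\<^sup>+v. ennreal ((cmod (lam v))\<^sup>2) * (\<integral>\<^sup>+s. ennreal s ^ n \<partial>\<mu> v) \<partial>count_space (Chi V E u))"
    by (rule nn_integral_weighted_sum_measure) (use sets in auto)
  also have "\<dots> = ennreal (wshift_moments V E lam u (Suc n))"
    unfolding wshift_moments_Suc[OF tree T u] by (intro nn_integral_cong) (simp add: mom)
  finally show "(\<integral>\<^sup>+s. ennreal s ^ n \<partial>?P) = ennreal (wshift_moments V E lam u (Suc n))" .
qed

text \<open>The formula is asserted for every representing measure of the moments of
  \<open>u\<close>. The truncated difference in it is a genuine one, since the sum is at most 1 once
  such a measure exists.\<close>

theorem lemma6p1p10: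
  fixes V :: "'a set" and E :: "('a \<times> 'a) set" and lam :: "'a \<Rightarrow> complex"
    and u :: 'a and \<mu> :: "'a \<Rightarrow> real measure"
  assumes "directed_tree V E"
    and "l2_bounded_operator V (wshift_domain V E lam) (wshift V E lam)"
    and "u \<in> V" and "Chi V E u \<noteq> {}"
    and "\<And>v. v \<in> Chi V E u \<Longrightarrow> stieltjes_moment_sequence (wshift_moments V E lam v)"
    and "\<And>v. v \<in> Chi V E u \<Longrightarrow> stieltjes_represents (\<mu> v) (wshift_moments V E lam v)"
  shows "(stieltjes_moment_sequence (wshift_moments V E lam u) \<longleftrightarrow> consistent_at V E lam \<mu> u) \<and>
    (stieltjes_moment_sequence (wshift_moments V E lam u) \<longrightarrow>
      (\<forall>v\<in>Chi V E u. lam v \<noteq> 0 \<longrightarrow> emeasure (\<mu> v) {0} = 0) \<and>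
      (\<forall>\<mu>\<^sub>u. stieltjes_represents \<mu>\<^sub>u (wshift_moments V E lam u) \<longrightarrow>
        (\<forall>\<sigma>\<in>sets borel.
          emeasure \<mu>\<^sub>u \<sigma> = consistency_sum V E lam \<mu> u \<sigma> +
            (1 - consistency_sum V E lam \<mu> u {0..}) * emeasure (return borel (0::real)) \<sigma>) \<and>
        (emeasure \<mu>\<^sub>u {0} = 0 \<longleftrightarrow> strongly_consistent_at V E lam \<mu> u)))"
proof -
  let ?t = "wshift_moments V E lam u" and ?S = "consistency_sum V E lam \<mu> u"
  define P where "P = weighted_sum_measure (Chi V E u) (\<lambda>v. ennreal ((cmod (lam v))\<^sup>2)) \<mu>"
  have sets: "sets (\<mu> v) = sets borel" if "v \<in> Chi V E u" for v
    using assms(6)[OF that] by (simp add: stieltjes_represents_def)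
  have P: "stieltjes_represents P (\<lambda>n. ?t (Suc n))"
    unfolding P_def by (rule stieltjes_represents_weighted_sum_measure[OF assms(1-3,6)])
  have S: "?S \<sigma> = recip_integral P \<sigma>" if "\<sigma> \<in> sets borel" for \<sigma>
    unfolding P_def by (rule consistency_sum_eq_recip_integral[OF sets that])
  obtain R where R: "0 \<le> R" "\<And>n. ?t n \<le> 1 * R ^ n"
    using wshift_moments_bounded[OF assms(2)] assms(3) by (metis mult_1)
  have t0: "?t 0 = 1"
    by (rule wshift_moments_0[OF assms(3)])
  have suff: "stieltjes_moment_sequence ?t" if "consistent_at V E lam \<mu> u"
    using that S[of "{0..}"] t0
    by (intro stieltjes_moment_sequence_backward_extension[OF P]) (auto simp: consistent_at_def)
  \<comment> \<open>The consistency sum over a Borel set is the \<open>N\<close>-mass of its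
    positive part; the remaining claims about \<open>N\<close> follow by splitting at 0.\<close>
  have S_eq: "?S \<sigma> = emeasure N (\<sigma> \<inter> {0<..})" if "stieltjes_represents N ?t" "\<sigma> \<in> sets borel" for N \<sigma>
    using recip_integral_shifted(1)[OF that(1) P R(2,1) that(2)] S[OF that(2)] by simp
  have zero: "emeasure (\<mu> v) {0} = 0"
    if N: "stieltjes_represents N ?t" and v: "v \<in> Chi V E u" "lam v \<noteq> 0" for N v
  proof -
    let ?f = "\<lambda>v. ennreal ((cmod (lam v))\<^sup>2) * emeasure (\<mu> v) {0}"
    \<comment> \<open>A single child's weighted atom is one term of the sum giving the atom of
      \<open>P\<close> at 0, which vanishes.\<close>
    have "?f v \<le> (\<integral>\<^sup>+v. ?f v \<partial>count_space (Chi V E u))"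
      by (rule nn_integral_ge_point[OF v(1)])
    also have "\<dots> = emeasure P {0}"
      unfolding P_def by (rule emeasure_weighted_sum_measure[symmetric]) (use sets in auto)
    also have "\<dots> = 0"
      by (rule recip_integral_shifted(2)[OF N P R(2,1)])
    finally show ?thesis
      using v(2) by simp
  qed
  have mass: "?S {0..} + emeasure N {0} = 1" and decomp: "\<sigma> \<in> sets borel \<Longrightarrow> emeasure N \<sigma> = ?S \<sigma> + emeasure N {0} * indicator \<sigma> 0"
    if N: "stieltjes_represents N ?t" for N \<sigma>
  proof -
    have sN: "sets N = sets borel" and null: "emeasure N (- {0..}) = 0"
      and "(\<integral>\<^sup>+s. ennreal s ^ 0 \<partial>N) = ennreal (?t 0)"
      using N unfolding stieltjes_represents_iff_nn_integral by blast+
    then have total: "emeasure N UNIV = 1"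
      using sets_eq_imp_space_eq[OF sN] t0 by simp
    have pos: "AE s in N. 0 \<le> s"
      by (rule AE_I[OF _ null]) (auto simp: sN)
    show *: "emeasure N \<sigma> = ?S \<sigma> + emeasure N {0} * indicator \<sigma> 0" if \<sigma>: "\<sigma> \<in> sets borel" for \<sigma>
    proof -
      have "emeasure N \<sigma> = emeasure N ((\<sigma> \<inter> {0<..}) \<union> (\<sigma> \<inter> {0}))"
        by (rule emeasure_eq_AE, use pos in eventually_elim) (use \<sigma> sN in auto)
      also have "\<dots> = emeasure N (\<sigma> \<inter> {0<..}) + emeasure N (\<sigma> \<inter> {0})"
        by (rule plus_emeasure[symmetric]) (use \<sigma> sN in auto)
      also have "emeasure N (\<sigma> \<inter> {0}) = emeasure N {0} * indicator \<sigma> 0"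
        by (auto split: split_indicator)
      finally show ?thesis by (simp add: S_eq[OF N \<sigma>])
    qed
    \<comment> \<open>Both \<open>{0..}\<close> and \<open>UNIV\<close> have positive part
      \<open>{0<..}\<close>, so \<open>decomp\<close> for \<open>UNIV\<close> yields the mass
      identity.\<close>
    have "{0..} \<inter> {0<..} = {0::real<..}" by auto
    then have "?S {0..} = ?S UNIV"
      by (simp add: S_eq[OF N])
    then show "?S {0..} + emeasure N {0} = 1"
      using *[of UNIV] total by simp
  qed
  \<comment> \<open>Cancellation in \<open>ennreal\<close> requires a finite term; finiteness comes
    from the total being 1.\<close>
  have N0: "emeasure N {0} = 1 - ?S {0..}" if "stieltjes_represents N ?t" for N
    using mass[OF that] by (metis add.commute ennreal_add_diff_cancel_right ennreal_add_eq_top ennreal_one_neq_top)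
  have le1: "?S {0..} \<le> 1" if "stieltjes_represents N ?t" for N
    using mass[OF that] by (metis le_iff_add)
  have strong: "emeasure N {0} = 0 \<longleftrightarrow> strongly_consistent_at V E lam \<mu> u"
    if "stieltjes_represents N ?t" for N
  proof
    assume "emeasure N {0} = 0"
    then show "strongly_consistent_at V E lam \<mu> u"
      using mass[OF that] by (simp add: strongly_consistent_at_def)
  qed (simp add: N0[OF that] strongly_consistent_at_def)
  show ?thesis
    using suff le1 zero decomp strong N0
    unfolding stieltjes_moment_sequence_def consistent_at_def
    by (simp add: emeasure_return) blast
qed

end
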